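(* Let $(a,b,c,d)$ be an (unordered) primitive integral Descartes quadruple, other than $(0,0,1,1)$, none of whose entries is $0$. Then the geometric standard strongly integral super-packing contains a Descartes configuration whose curvatures are $a,b,c,d$ and whose largest circle (a circle of maximal radius in the configuration) has its center in the closed unit square $\{(x,y):0\le x\le1,\ 0\le y\le1\}$. The location of the center of this largest circle is unique.
   Context: Circles are taken in $\hat{\mathbb C}=\mathbb R^2\cup\{\infty\}$; lines count as circles. A Descartes configuration is a set of four mutually tangent circles with disjoint interiors; its signed curvatures are reciprocal radii, negative for the circle whose interior is unbounded (if any), $0$ for lines. An integral Descartes quadruple is a quadruple of integers that are the signed curvatures of some Descartes configuration; it is primitive if its gcd is $1$. Ordered, oriented Descartes configurations have augmented curvature-center coordinate matrices $W_{\mathcal D}$ with $i$-th row $(\bar b_i,b_i,b_ix_i,b_iy_i)$, $(x_i,y_i)$ the center, $\bar b_i=b_i(x_i^2+y_i^2)-1/b_i$ (for a line: $(2p\cdot n,0,n_x,n_y)$, $n$ the unit normal pointing into the interior half-plane, $p$ a point on the line). Let $S_i$ be the $4\times4$ integer matrix equal to the identity except that row $i$ has $-1$ in position $i$ and $2$ elsewhere, $S_i^\perp=S_i^T$, and $\mathcal A^S=\langle S_i,S_i^\perp\rangle$ the super-Apollonian group, acting by $W_{U[\mathcal D]}=UW_{\mathcal D}$. The geometric super-packing generated by $\mathcal D$ is the set of circles of configurations in $\mathcal A^S[\mathcal D]$. The geometric standard strongly integral super-packing is the one generated by the configuration $\mathcal D_1$ with $W_{\mathcal D_1}=\begin{pmatrix}2&0&0&1\\2&0&0&-1\\0&1&1&0\\0&1&-1&0\end{pmatrix}$,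 i.e. the lines $y=\pm1$ and the unit circles centered at $(\pm1,0)$. "Contains a Descartes configuration" means all four of its circles belong to the super-packing and the configuration lies in the orbit $\mathcal A^S[\mathcal D_1]$ up to ordering and orientation. *)

theory Defs
  imports "HOL-Analysis.Analysis" "HOL-Library.Multiset"
begin

text \<open>Oriented generalized circles in the plane (identified with the complex numbers).
  Circ c k: circle with center c and signed curvature k (k \<noteq> 0), radius 1/|k|;
    its interior is the open disk if k > 0 and the complement of the closed disk if k < 0.
  Line p n: the line through p with unit normal n; its interior is the open half-plane
    into which n points. Lines pass through the point at infinity.\<close>

datatype ocircle = Circ complex real | Line complex complex

fun wf_circle :: "ocircle \<Rightarrow> bool" where
  "wf_circle (Circ c k) = (k \<noteq> 0)"
| "wf_circle (Line p n) = (norm n = 1)"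

fun curv :: "ocircle \<Rightarrow> real" where
  "curv (Circ c k) = k"
| "curv (Line p n) = 0"

fun is_line :: "ocircle \<Rightarrow> bool" where
  "is_line (Circ c k) = False"
| "is_line (Line p n) = True"

fun bdry :: "ocircle \<Rightarrow> complex set" where
  "bdry (Circ c k) = sphere c (1 / \<bar>k\<bar>)"
| "bdry (Line p n) = {z. inner (z - p) n = 0}"

fun cinterior :: "ocircle \<Rightarrow> complex set" where
  "cinterior (Circ c k) = (if k > 0 then ball c (1 / k) else UNIV - cball c (1 / \<bar>k\<bar>))"
| "cinterior (Line p n) = {z. inner (z - p) n > 0}"

text \<open>Tangency in the extended plane: the two circles meet in exactly one point of
  \<open>\<complex> \<union> {\<infinity>}\<close> (two lines always share \<infinity>).\<close>
definition tangent :: "ocircle \<Rightarrow> ocircle \<Rightarrow> bool" where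
  "tangent C D \<longleftrightarrow>
     (if is_line C \<and> is_line D then bdry C \<inter> bdry D = {}
      else (\<exists>!z. z \<in> bdry C \<inter> bdry D))"

definition descartes :: "(4 \<Rightarrow> ocircle) \<Rightarrow> bool" where
  "descartes C \<longleftrightarrow> (\<forall>i. wf_circle (C i)) \<and>
     (\<forall>i j. i \<noteq> j \<longrightarrow> cinterior (C i) \<inter> cinterior (C j) = {} \<and> tangent (C i) (C j))"

definition curv_mset :: "(4 \<Rightarrow> ocircle) \<Rightarrow> real multiset" where
  "curv_mset C = image_mset (\<lambda>i. curv (C i)) (mset_set UNIV)"

definition integral_descartes_quadruple :: "int \<Rightarrow> int \<Rightarrow> int \<Rightarrow> int \<Rightarrow> bool" where
  "integral_descartes_quadruple a b c d \<longleftrightarrow>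
     (\<exists>C. descartes C \<and> curv_mset C = {#of_int a, of_int b, of_int c, of_int d#})"

definition primitive :: "int \<Rightarrow> int \<Rightarrow> int \<Rightarrow> int \<Rightarrow> bool" where
  "primitive a b c d \<longleftrightarrow> gcd a (gcd b (gcd c d)) = 1"

fun wrow :: "ocircle \<Rightarrow> real^4" where
  "wrow (Circ c k) = vector [k * (norm c)^2 - 1 / k, k, k * Re c, k * Im c]"
| "wrow (Line p n) = vector [2 * inner p n, 0, Re n, Im n]"

definition Wmat :: "(4 \<Rightarrow> ocircle) \<Rightarrow> real^4^4" where
  "Wmat C = (\<chi> i. wrow (C i))"

definition W_D1 :: "real^4^4" where
  "W_D1 = vector [vector [2, 0, 0, 1], vector [2, 0, 0, -1],
                  vector [0, 1, 1, 0], vector [0, 1, -1, 0]]"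

definition S_mat :: "4 \<Rightarrow> real^4^4" where
  "S_mat i = (\<chi> r c. if r = i then (if c = i then -1 else 2) else (if r = c then 1 else 0))"

text \<open>The super-Apollonian group generated by the S_i and S_i^T (all generators are
  involutions, so the generated monoid is the generated group).\<close>
inductive_set superA :: "(real^4^4) set" where
  id: "mat 1 \<in> superA"
| S: "U \<in> superA \<Longrightarrow> S_mat i ** U \<in> superA"
| ST: "U \<in> superA \<Longrightarrow> transpose (S_mat i) ** U \<in> superA"

text \<open>C lies in the orbit of D1 up to ordering and orientation (reversing the
  orientation of a circle negates its row).\<close>
definition in_super_orbit :: "(4 \<Rightarrow> ocircle) \<Rightarrow> bool" where
  "in_super_orbit C \<longleftrightarrow>
     (\<exists>U \<in> superA. \<exists>\<pi> :: 4 \<Rightarrow> 4. \<exists>\<epsilon> :: 4 \<Rightarrow> real. bij \<pi> \<and> (\<forall>i. \<epsilon> i \<in> {1, -1}) \<and>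
        (\<forall>i. (U ** W_D1) $ (\<pi> i) = \<epsilon> i *\<^sub>R wrow (C i)))"

definition largest_circle_center :: "(4 \<Rightarrow> ocircle) \<Rightarrow> complex \<Rightarrow> bool" where
  "largest_circle_center C z \<longleftrightarrow>
     (\<exists>i k. C i = Circ z k \<and> (\<forall>j. \<bar>k\<bar> \<le> \<bar>curv (C j)\<bar>))"

definition unit_square :: "complex set" where
  "unit_square = {z. 0 \<le> Re z \<and> Re z \<le> 1 \<and> 0 \<le> Im z \<and> Im z \<le> 1}"

end

theory Submission
  imports Defs
begin

text \<open>A configuration is encoded by the four rows of its augmented curvature-center matrix. For the
  bilinear form \<open>ip\<close> of signature \<open>(3, 1)\<close> on rows, being a Descartes configuration means that the
  Gram matrix has \<open>1\<close> on the diagonal and \<open>-1\<close> elsewhere, up to a positivity condition on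
  the curvatures that settles the orientation.

  Existence: on null vectors of curvatures, the moves \<open>S_i\<close> and \<open>S_i\<^sup>T\<close> decrease the absolute
  value of the sum until a multiple of \<open>(0, 0, 1, 1)\<close> is reached, and primitivity makes the
  multiplier \<open>1\<close> or \<open>-1\<close>. So the quadruple is the curvature vector of some configuration in the
  super-orbit. The super-orbit is invariant under the reflections in the sides of the unit
  square, because the reflected base configuration is a reordering of the base configuration or
  its image under \<open>S_4\<close> or \<open>S_1\<^sup>T\<close>; these reflections move any center into the square.

  Uniqueness: reducing two configurations with the same curvatures by the same moves, the first
  one becomes the base configuration and the second one has curvatures \<open>(0, 0, 1, 1)\<close>, too. The
  congruences satisfied by all rows in the orbit force the isometry between them to be
  \<open>x \<mapsto> \<plusminus>x + 2s, y \<mapsto> \<plusminus>y + 2t\<close>, and no two points of the square are related in this way.\<close>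

subsection \<open>The super-Apollonian action on rows\<close>

lemma vector_4 [simp]:
  "(vector [a, b, c, d] :: 'a::zero^4) $ 1 = a"
  "(vector [a, b, c, d] :: 'a::zero^4) $ 2 = b"
  "(vector [a, b, c, d] :: 'a::zero^4) $ 3 = c"
  "(vector [a, b, c, d] :: 'a::zero^4) $ 4 = d"
  unfolding vector_def by simp_all

text \<open>The rule 2 (sum of the other rows) - r_j is rewritten with the sum of all rows, which
  does not depend on their order.\<close>

lemma S_mat_mult_row:
  "(S_mat j ** M) $ i = (if i = j then 2 *\<^sub>R (\<Sum>k\<in>UNIV. M $ k) - 3 *\<^sub>R M $ j else M $ i)"
proof (cases "i = j")
  case True
  have "(\<Sum>k\<in>UNIV. (if k = j then -1 else 2) * M $ k $ c)
      = 2 * (\<Sum>k\<in>UNIV. M $ k $ c) - 3 * M $ j $ c" for c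
    by (simp add: sum.remove[of UNIV j] sum_distrib_left)
  with True show ?thesis
    by (simp add: vec_eq_iff matrix_matrix_mult_def S_mat_def)
next
  case False
  have "(\<Sum>k\<in>UNIV. (if i = k then 1 else 0) * M $ k $ c) = M $ i $ c" for c
    by (simp add: if_distrib[of "\<lambda>x. x * _"] cong: if_cong)
  with False show ?thesis
    by (simp add: vec_eq_iff matrix_matrix_mult_def S_mat_def)
qed

lemma transpose_S_mat_mult_row:
  "(transpose (S_mat j) ** M) $ i = (if i = j then - M $ j else M $ i + 2 *\<^sub>R M $ j)"
proof (cases "i = j")
  case True
  have "(\<Sum>k\<in>UNIV. (if k = j then -1 else if k = j then 1 else 0) * M $ k $ c)
      = - M $ j $ c" for c
    by (simp add: sum.remove[of UNIV j])
  with True show ?thesis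
    by (simp add: vec_eq_iff matrix_matrix_mult_def S_mat_def transpose_def)
next
  case False
  have "(\<Sum>k\<in>UNIV. (if k = j then 2 else if k = i then 1 else 0) * M $ k $ c)
      = M $ i $ c + 2 * M $ j $ c" for c
    using False by (simp add: sum.remove[of UNIV j] if_distrib[of "\<lambda>x. x * _"] cong: if_cong)
  with False show ?thesis
    by (simp add: vec_eq_iff matrix_matrix_mult_def S_mat_def transpose_def)
qed

lemma S_mat_involution: "S_mat j ** (S_mat j ** M) = M"
  by (simp add: vec_eq_iff S_mat_mult_row sum.remove[of UNIV j] algebra_simps)

lemma transpose_S_mat_involution: "transpose (S_mat j) ** (transpose (S_mat j) ** M) = M"
  by (simp add: vec_eq_iff transpose_S_mat_mult_row)

definition permute_rows :: "(4 \<Rightarrow> 4) \<Rightarrow> real^4^4 \<Rightarrow> real^4^4" where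
  "permute_rows \<pi> M = (\<chi> i. M $ \<pi> i)"

lemma permute_rows_nth [simp]: "permute_rows \<pi> M $ i = M $ \<pi> i"
  by (simp add: permute_rows_def)

text \<open>Closing under row permutations makes this the orbit of unordered configurations.\<close>
inductive_set orbit :: "(real^4^4) set" where
  base: "W_D1 \<in> orbit"
| S: "M \<in> orbit \<Longrightarrow> S_mat j ** M \<in> orbit"
| ST: "M \<in> orbit \<Longrightarrow> transpose (S_mat j) ** M \<in> orbit"
| perm: "M \<in> orbit \<Longrightarrow> bij \<pi> \<Longrightarrow> permute_rows \<pi> M \<in> orbit"

lemma superA_mult_W_D1_in_orbit: "U \<in> superA \<Longrightarrow> U ** W_D1 \<in> orbit"
  by (induction rule: superA.induct)
    (auto simp: matrix_mul_assoc[symmetric] intro: orbit.intros)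

text \<open>Conjugating by a row permutation \<pi> turns the generator with index j into the one
  with index \<pi> j. Hence all permutations can be moved to the outside and collected into
  one.\<close>

lemma orbit_imp_superA:
  assumes "M \<in> orbit"
  shows "\<exists>U\<in>superA. \<exists>\<pi>. bij \<pi> \<and> M = permute_rows \<pi> (U ** W_D1)"
  using assms
proof (induction rule: orbit.induct)
  case base
  show ?case
    by (intro bexI[OF _ superA.id] exI[of _ id] conjI bij_id) (simp add: vec_eq_iff)
next
  case (S M j)
  then obtain U \<pi> where U: "U \<in> superA" "bij \<pi>" "M = permute_rows \<pi> (U ** W_D1)" by blast
  have "(\<Sum>k\<in>UNIV. (U ** W_D1) $ \<pi> k) = (\<Sum>k\<in>UNIV. (U ** W_D1) $ k)"
    by (rule sum.reindex_bij_betw[OF U(2)])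
  then have "S_mat j ** M = permute_rows \<pi> ((S_mat (\<pi> j) ** U) ** W_D1)"
    using U(2) unfolding U(3) matrix_mul_assoc[symmetric]
    by (auto simp: vec_eq_iff S_mat_mult_row bij_is_inj inj_eq simp flip: sum_component)
  with U superA.S show ?case by blast
next
  case (ST M j)
  then obtain U \<pi> where U: "U \<in> superA" "bij \<pi>" "M = permute_rows \<pi> (U ** W_D1)" by blast
  have "transpose (S_mat j) ** M = permute_rows \<pi> ((transpose (S_mat (\<pi> j)) ** U) ** W_D1)"
    using U(2) unfolding U(3) matrix_mul_assoc[symmetric]
    by (auto simp: vec_eq_iff transpose_S_mat_mult_row bij_is_inj inj_eq)
  with U superA.ST show ?case by blast
next
  case (perm M \<rho>)
  then obtain U \<pi> where U: "U \<in> superA" "bij \<pi>" "M = permute_rows \<pi> (U ** W_D1)" by blast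
  have "permute_rows \<rho> M = permute_rows (\<pi> \<circ> \<rho>) (U ** W_D1)"
    by (simp add: U(3) vec_eq_iff)
  with U perm.hyps bij_comp show ?case by blast
qed

lemma in_super_orbit_iff_orbit:
  "in_super_orbit C \<longleftrightarrow>
     (\<exists>M\<in>orbit. \<exists>\<epsilon> :: 4 \<Rightarrow> real. (\<forall>i. \<epsilon> i \<in> {1, -1}) \<and> (\<forall>i. M $ i = \<epsilon> i *\<^sub>R wrow (C i)))"
proof
  assume "in_super_orbit C"
  then obtain U \<pi> \<epsilon> where U: "U \<in> superA" "bij \<pi>" "\<forall>i. \<epsilon> i \<in> {1, -1::real}"
      "\<forall>i. (U ** W_D1) $ \<pi> i = \<epsilon> i *\<^sub>R wrow (C i)"
    unfolding in_super_orbit_def by blast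
  then have "permute_rows \<pi> (U ** W_D1) \<in> orbit"
    by (intro orbit.perm superA_mult_W_D1_in_orbit)
  with U show "\<exists>M\<in>orbit. \<exists>\<epsilon>. (\<forall>i. \<epsilon> i \<in> {1, -1::real}) \<and> (\<forall>i. M $ i = \<epsilon> i *\<^sub>R wrow (C i))"
    by (intro bexI[of _ "permute_rows \<pi> (U ** W_D1)"] exI[of _ \<epsilon>]) auto
next
  assume "\<exists>M\<in>orbit. \<exists>\<epsilon>. (\<forall>i. \<epsilon> i \<in> {1, -1::real}) \<and> (\<forall>i. M $ i = \<epsilon> i *\<^sub>R wrow (C i))"
  then obtain M \<epsilon> where M: "M \<in> orbit" "\<forall>i. \<epsilon> i \<in> {1, -1::real}"
    "\<forall>i. M $ i = \<epsilon> i *\<^sub>R wrow (C i)" by blast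
  obtain U \<pi> where U: "U \<in> superA" "bij \<pi>" "M = permute_rows \<pi> (U ** W_D1)"
    using orbit_imp_superA[OF M(1)] by blast
  then have "\<forall>i. (U ** W_D1) $ \<pi> i = \<epsilon> i *\<^sub>R wrow (C i)"
    using M(3) by simp
  with U M(2) show "in_super_orbit C"
    unfolding in_super_orbit_def by blast
qed

section \<open>The invariant form and the row lattice\<close>

text \<open>For positively oriented circles of radii r, s with centers at distance d this is (r^2 +
  s^2 - d^2) / (2 r s), so \<open>-1\<close> means external tangency. For a circle, having square
  \<open>1\<close> is the formula that defines the first coordinate.\<close>

definition ip :: "real^4 \<Rightarrow> real^4 \<Rightarrow> real" where
  "ip r s = r $ 3 * s $ 3 + r $ 4 * s $ 4 - (r $ 1 * s $ 2 + r $ 2 * s $ 1) / 2"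

lemma bilinear_ip: "bilinear ip"
  by (auto simp: bilinear_def ip_def field_simps intro!: linearI)

lemmas ip_simps =
  bilinear_ladd[OF bilinear_ip] bilinear_radd[OF bilinear_ip]
  bilinear_lsub[OF bilinear_ip] bilinear_rsub[OF bilinear_ip]
  bilinear_lmul[OF bilinear_ip] bilinear_rmul[OF bilinear_ip]
  bilinear_lneg[OF bilinear_ip] bilinear_rneg[OF bilinear_ip]

definition gram :: "real^4^4 \<Rightarrow> bool" where
  "gram M \<longleftrightarrow> (\<forall>i j. ip (M $ i) (M $ j) = (if i = j then 1 else -1))"

lemma gram_W_D1: "gram W_D1"
  by (simp add: gram_def forall_4 ip_def W_D1_def)

lemma gram_permute_rows: "gram M \<Longrightarrow> bij \<pi> \<Longrightarrow> gram (permute_rows \<pi> M)"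
  by (simp add: gram_def bij_is_inj inj_eq)

lemma ip_commute: "ip r s = ip s r"
  by (simp add: ip_def)

text \<open>Everything follows from the products of the row sum: 1 - 3 = -2 with each row, hence -8
  with itself. Geometrically, one circle is replaced by the other circle tangent to the remaining
  three.\<close>

lemma gram_S:
  assumes "gram M"
  shows "gram (S_mat j ** M)"
proof -
  let ?T = "\<Sum>k\<in>UNIV. M $ k"
  have ip: "ip (M $ i) (M $ k) = (if i = k then 1 else -1)" for i k
    using assms by (simp add: gram_def)
  have 1: "ip ?T (M $ i) = -2" for i
    using exhaust_4[of i] by (auto simp: sum_4 ip_simps ip)
  have "ip ?T ?T = (\<Sum>k\<in>UNIV. ip ?T (M $ k))"
    unfolding sum_4 ip_simps by simp
  then have 2: "ip ?T ?T = -8" by (simp add: 1)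
  show ?thesis
    using 1 1[THEN trans[OF ip_commute]] 2
    by (auto simp: gram_def S_mat_mult_row ip_simps ip)
qed

text \<open>On the rows of a matrix satisfying \<open>gram\<close>,
  \<open>transpose (S_mat j)\<close> is the reflection r \<mapsto> r - 2 \<open>ip\<close> r r_j
  r_j, an isometry; geometrically it is the inversion in circle j.\<close>

lemma gram_ST: "gram M \<Longrightarrow> gram (transpose (S_mat j) ** M)"
  by (auto simp: gram_def transpose_S_mat_mult_row ip_simps)

lemma gram_orbit: "M \<in> orbit \<Longrightarrow> gram M"
  by (induction rule: orbit.induct)
    (auto intro: gram_W_D1 gram_S gram_ST gram_permute_rows)

lemma gram_scaleR: "gram M \<Longrightarrow> \<sigma> * \<sigma> = 1 \<Longrightarrow> gram (\<sigma> *\<^sub>R M)"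
  by (simp add: gram_def ip_simps flip: mult.assoc)

text \<open>The lattice spanned by the rows of \<open>W_D1\<close>.\<close>
definition row_lattice :: "(real^4) set" where
  "row_lattice = {r. \<exists>b n s p :: int. r = vector [2 * n + 4 * p, b, b + 2 * s, n]}"

lemma row_latticeI:
  "r $ 1 = 2 * of_int n + 4 * of_int p \<Longrightarrow> r $ 2 = of_int b \<Longrightarrow> r $ 3 = of_int b + 2 * of_int s \<Longrightarrow>
     r $ 4 = of_int n \<Longrightarrow> r \<in> row_lattice"
  unfolding row_lattice_def mem_Collect_eq
  by (intro exI[of _ b] exI[of _ n] exI[of _ s] exI[of _ p]) (simp add: vec_eq_iff forall_4)

lemma row_latticeE:
  assumes "r \<in> row_lattice"
  obtains b n s p :: int where "r $ 1 = 2 * of_int n + 4 * of_int p" "r $ 2 = of_int b"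
    "r $ 3 = of_int b + 2 * of_int s" "r $ 4 = of_int n"
  using assms unfolding row_lattice_def by auto

lemma row_lattice_add:
  assumes "r \<in> row_lattice" "r' \<in> row_lattice"
  shows "r + r' \<in> row_lattice"
proof -
  obtain b n s p :: int where 1: "r $ 1 = 2 * of_int n + 4 * of_int p" "r $ 2 = of_int b"
      "r $ 3 = of_int b + 2 * of_int s" "r $ 4 = of_int n"
    using row_latticeE[OF assms(1)] by metis
  obtain b' n' s' p' :: int where 2: "r' $ 1 = 2 * of_int n' + 4 * of_int p'" "r' $ 2 = of_int b'"
      "r' $ 3 = of_int b' + 2 * of_int s'" "r' $ 4 = of_int n'"
    using row_latticeE[OF assms(2)] by metis
  show ?thesis
    by (rule row_latticeI[of _ "n + n'" "p + p'" "b + b'" "s + s'"]) (simp_all add: 1 2)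
qed

lemma row_lattice_scale:
  assumes "r \<in> row_lattice"
  shows "of_int k *\<^sub>R r \<in> row_lattice"
proof -
  obtain b n s p :: int where 1: "r $ 1 = 2 * of_int n + 4 * of_int p" "r $ 2 = of_int b"
      "r $ 3 = of_int b + 2 * of_int s" "r $ 4 = of_int n"
    using row_latticeE[OF assms(1)] by metis
  show ?thesis
    by (rule row_latticeI[of _ "k * n" "k * p" "k * b" "k * s"]) (simp_all add: 1 algebra_simps)
qed

lemma row_lattice_uminus: "r \<in> row_lattice \<Longrightarrow> - r \<in> row_lattice"
  using row_lattice_scale[of r "-1"] by simp

lemma row_lattice_S:
  assumes "\<And>i. M $ i \<in> row_lattice"
  shows "(S_mat j ** M) $ i \<in> row_lattice"
proof -
  have "of_int 2 *\<^sub>R (\<Sum>k\<in>UNIV. M $ k) + of_int (-3) *\<^sub>R M $ j \<in> row_lattice"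
    unfolding sum_4 by (intro row_lattice_add row_lattice_scale assms)
  then show ?thesis by (simp add: S_mat_mult_row assms)
qed

lemma row_lattice_ST:
  assumes "\<And>i. M $ i \<in> row_lattice"
  shows "(transpose (S_mat j) ** M) $ i \<in> row_lattice"
  using row_lattice_add[OF assms row_lattice_scale[OF assms, of 2]]
  by (simp add: transpose_S_mat_mult_row assms row_lattice_uminus)

lemma row_lattice_orbit: "M \<in> orbit \<Longrightarrow> M $ i \<in> row_lattice"
proof (induction arbitrary: i rule: orbit.induct)
  case base
  have "W_D1 $ 1 \<in> row_lattice"
    by (rule row_latticeI[of _ 1 0 0 0]) (simp_all add: W_D1_def)
  moreover have "W_D1 $ 2 \<in> row_lattice"
    by (rule row_latticeI[of _ "-1" 1 0 0]) (simp_all add: W_D1_def)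
  moreover have "W_D1 $ 3 \<in> row_lattice"
    by (rule row_latticeI[of _ 0 0 1 0]) (simp_all add: W_D1_def)
  moreover have "W_D1 $ 4 \<in> row_lattice"
    by (rule row_latticeI[of _ 0 0 1 "-1"]) (simp_all add: W_D1_def)
  ultimately show ?case using exhaust_4[of i] by metis
qed (auto intro: row_lattice_S row_lattice_ST)

section \<open>Symmetries of the orbit\<close>

text \<open>The generators form linear combinations of rows, so they commute with a linear map
  applied to every row. A symmetry of the orbit therefore has to be checked on the base
  configuration only.\<close>

lemma orbit_linear_image:
  assumes f: "linear f" and "(\<chi> i. f (W_D1 $ i)) \<in> orbit" and "M \<in> orbit"
  shows "(\<chi> i. f (M $ i)) \<in> orbit"
  using assms(3)
proof (induction rule: orbit.induct)
  case base
  show ?case by (fact assms(2))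
next
  case (S M j)
  have "(\<chi> i. f ((S_mat j ** M) $ i)) = S_mat j ** (\<chi> i. f (M $ i))"
    by (simp add: vec_eq_iff S_mat_mult_row linear_diff[OF f] linear_scale[OF f] linear_sum[OF f])
  with S.IH orbit.S show ?case by simp
next
  case (ST M j)
  have "(\<chi> i. f ((transpose (S_mat j) ** M) $ i)) = transpose (S_mat j) ** (\<chi> i. f (M $ i))"
    by (simp add: vec_eq_iff transpose_S_mat_mult_row linear_add[OF f] linear_scale[OF f] linear_neg[OF f])
  with ST.IH orbit.ST show ?case by simp
next
  case (perm M \<pi>)
  have "(\<chi> i. f (permute_rows \<pi> M $ i)) = permute_rows \<pi> (\<chi> i. f (M $ i))"
    by (simp add: vec_eq_iff)
  with perm.IH orbit.perm[OF _ perm.hyps(2)] show ?case by metis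
qed

text \<open>In terms of centers these are x \<mapsto> -x, y \<mapsto> -y, x \<mapsto> 2 - x and y
  \<mapsto> 2 - y. The change of the first coordinate in the last two comes from expanding b (2 -
  x)^2 and b (2 - y)^2.\<close>

lemma orbit_reflections:
  assumes "M \<in> orbit"
  shows "(\<chi> i. vector [M $ i $ 1, M $ i $ 2, - M $ i $ 3, M $ i $ 4]) \<in> orbit" (is ?a)
    and "(\<chi> i. vector [M $ i $ 1, M $ i $ 2, M $ i $ 3, - M $ i $ 4]) \<in> orbit" (is ?b)
    and "(\<chi> i. vector [M $ i $ 1 - 4 * M $ i $ 3 + 4 * M $ i $ 2, M $ i $ 2,
            2 * M $ i $ 2 - M $ i $ 3, M $ i $ 4]) \<in> orbit" (is ?c)
    and "(\<chi> i. vector [M $ i $ 1 - 4 * M $ i $ 4 + 4 * M $ i $ 2, M $ i $ 2,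
            M $ i $ 3, 2 * M $ i $ 2 - M $ i $ 4]) \<in> orbit" (is ?d)
proof -
  let ?f = "\<lambda>r::real^4. vector [r$1, r$2, - r$3, r$4] :: real^4"
  let ?g = "\<lambda>r::real^4. vector [r$1, r$2, r$3, - r$4] :: real^4"
  let ?h = "\<lambda>r::real^4. vector [r$1 - 4 * r$3 + 4 * r$2, r$2, 2 * r$2 - r$3, r$4] :: real^4"
  let ?k = "\<lambda>r::real^4. vector [r$1 - 4 * r$4 + 4 * r$2, r$2, r$3, 2 * r$2 - r$4] :: real^4"
  have lin: "linear ?f" "linear ?g" "linear ?h" "linear ?k"
    by (auto intro!: linearI simp: vec_eq_iff forall_4 algebra_simps)
  have "(\<chi> i. ?f (W_D1 $ i)) = permute_rows (Transposition.transpose 3 4) W_D1"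
    by (simp add: vec_eq_iff forall_4 W_D1_def Transposition.transpose_def)
  then have "(\<chi> i. ?f (W_D1 $ i)) \<in> orbit"
    using orbit.perm[OF orbit.base bij_transpose] by metis
  from orbit_linear_image[OF lin(1) this assms] show ?a .
  have "(\<chi> i. ?g (W_D1 $ i)) = permute_rows (Transposition.transpose 1 2) W_D1"
    by (simp add: vec_eq_iff forall_4 W_D1_def Transposition.transpose_def)
  then have "(\<chi> i. ?g (W_D1 $ i)) \<in> orbit"
    using orbit.perm[OF orbit.base bij_transpose] by metis
  from orbit_linear_image[OF lin(2) this assms] show ?b .
  have "(\<chi> i. ?h (W_D1 $ i)) = S_mat 4 ** W_D1"
    by (simp add: vec_eq_iff forall_4 S_mat_mult_row sum_4) (simp add: W_D1_def)
  then have "(\<chi> i. ?h (W_D1 $ i)) \<in> orbit"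
    using orbit.S[OF orbit.base] by metis
  from orbit_linear_image[OF lin(3) this assms] show ?c .
  have "(\<chi> i. ?k (W_D1 $ i)) = transpose (S_mat 1) ** W_D1"
    by (simp add: vec_eq_iff forall_4 transpose_S_mat_mult_row) (simp add: W_D1_def)
  then have "(\<chi> i. ?k (W_D1 $ i)) \<in> orbit"
    using orbit.ST[OF orbit.base] by metis
  from orbit_linear_image[OF lin(4) this assms] show ?d .
qed

text \<open>The two reflections compose to the translation by -2. Translating \<bar>x\<bar> by an
  even integer brings it into [-1, 1), and a final change of sign makes it nonnegative.\<close>

lemma reflections_reach_unit_interval:
  fixes P :: "real \<Rightarrow> bool"
  assumes "P x" and minus: "\<And>x. P x \<Longrightarrow> P (- x)" and refl: "\<And>x. P x \<Longrightarrow> P (2 - x)"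
  shows "\<exists>y. 0 \<le> y \<and> y \<le> 1 \<and> P y"
proof -
  have "P (\<bar>x\<bar> - 2 * real n)" for n
  proof (induction n)
    case 0
    show ?case using assms(1) minus[OF assms(1)] by (simp add: abs_if)
  next
    case (Suc n)
    show ?case using minus[OF refl[OF Suc.IH]] by (simp add: algebra_simps)
  qed
  then have P: "P (\<bar>x\<bar> - 2 * real (nat \<lfloor>(\<bar>x\<bar> + 1) / 2\<rfloor>))" (is "P ?y") .
  have "real (nat \<lfloor>(\<bar>x\<bar> + 1) / 2\<rfloor>) = of_int \<lfloor>(\<bar>x\<bar> + 1) / 2\<rfloor>"
    by simp
  moreover have "of_int \<lfloor>(t + 1) / 2\<rfloor> \<le> (t + 1) / 2" "(t + 1) / 2 < of_int \<lfloor>(t + 1) / 2\<rfloor> + 1" for t :: real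
    by linarith+
  from this[of "\<bar>x\<bar>"] have "\<bar>\<bar>x\<bar> - 2 * of_int \<lfloor>(\<bar>x\<bar> + 1) / 2\<rfloor>\<bar> \<le> 1"
    unfolding abs_le_iff by (simp add: field_simps)
  ultimately have "\<bar>?y\<bar> \<le> 1" by simp
  then show ?thesis
    using P minus[OF P] by (intro exI[of _ "\<bar>?y\<bar>"]) (auto simp: abs_if)
qed

subsection \<open>Reduction of curvature vectors\<close>

lemma sum_fun_upd:
  fixes v :: "'a::finite \<Rightarrow> 'b::ab_group_add"
  shows "sum (v(i := x)) UNIV = sum v UNIV - v i + x"
proof -
  have "sum (v(i := x)) UNIV = x + sum (v(i := x)) (UNIV - {i})"
    by (subst sum.remove[of UNIV i "v(i := x)"]) simp_all
  also have "sum (v(i := x)) (UNIV - {i}) = sum v (UNIV - {i})"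
    by (rule sum.cong) auto
  finally show ?thesis
    by (simp add: sum.remove[of UNIV i v])
qed

text \<open>The end of the descent: \<open>upper\<close> and \<open>lower\<close> say that no move
  \<open>S_mat i\<close> or its transpose makes the sum smaller in absolute value. They rule out
  negative entries and then leave only \<open>0\<close> and half the sum as values.\<close>

lemma reduced_null_vector:
  fixes v :: "4 \<Rightarrow> int"
  assumes null: "2 * (\<Sum>i\<in>UNIV. (v i)\<^sup>2) = (\<Sum>i\<in>UNIV. v i)\<^sup>2"
    and pos: "(\<Sum>i\<in>UNIV. v i) > 0"
    and upper: "\<And>i. 2 * v i \<le> (\<Sum>i\<in>UNIV. v i)"
    and lower: "\<And>i. v i < 0 \<Longrightarrow> 2 * v i \<le> - (\<Sum>i\<in>UNIV. v i)"
  shows "\<exists>\<pi> h. bij \<pi> \<and> (\<forall>i. real_of_int (v i) = real_of_int h * W_D1 $ \<pi> i $ 2)"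
proof -
  define s where "s = (\<Sum>i\<in>UNIV. v i)"
  have s: "s = v 1 + v 2 + v 3 + v 4" by (simp add: s_def sum_4)
  have nonneg: "v i \<ge> 0" for i
  proof (rule ccontr)
    assume "\<not> v i \<ge> 0"
    then have i: "2 * v i \<le> - s" using lower by (simp add: s_def)
    \<comment> \<open>By the null condition the squares of the s - 2 v_j add up to 2 s^2, but a
      negative entry, being at most -s/2, alone contributes at least 4 s^2.\<close>
    have "(\<Sum>j\<in>UNIV. (s - 2 * v j)\<^sup>2) = 4 * (\<Sum>j\<in>UNIV. (v j)\<^sup>2)"
      by (simp add: s sum_4 power2_eq_square algebra_simps)
    also have "\<dots> = 2 * s\<^sup>2"
      using null by (simp add: s_def)
    finally have "(s - 2 * v i)\<^sup>2 \<le> 2 * s\<^sup>2"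
      using member_le_sum[of i UNIV "\<lambda>j. (s - 2 * v j)\<^sup>2"] by simp
    moreover have "(2 * s)\<^sup>2 \<le> (s - 2 * v i)\<^sup>2"
      using i pos by (intro power_mono) (auto simp: s_def)
    moreover have "s\<^sup>2 > 0"
      using pos by (simp add: s_def)
    ultimately show False
      by (simp add: power_mult_distrib)
  qed
  \<comment> \<open>The null condition is rewritten as a vanishing sum of terms that are now all
    nonnegative.\<close>
  have "(\<Sum>i\<in>UNIV. v i * (s - 2 * v i)) = s * s - 2 * (\<Sum>i\<in>UNIV. (v i)\<^sup>2)"
    by (simp add: s sum_4 algebra_simps power2_eq_square)
  also have "\<dots> = 0"
    using null by (simp add: s_def power2_eq_square)
  finally have "(\<Sum>i\<in>UNIV. v i * (s - 2 * v i)) = 0" .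
  moreover have "v i * (s - 2 * v i) \<ge> 0" for i
    using nonneg upper[of i] by (simp add: s_def)
  ultimately have "\<forall>i. v i * (s - 2 * v i) = 0"
    by (simp add: sum_nonneg_eq_0_iff)
  then have zero: "v i = 0 \<or> s = 2 * v i" for i
    by auto
  obtain i where "v i \<noteq> 0"
    using pos by (metis sum.neutral less_irrefl)
  then obtain h where h: "s = 2 * h"
    using zero by blast
  have vals: "v i = 0 \<or> v i = h" for i
    using zero[of i] h by auto
  have "h > 0" using pos h by (simp add: s_def)
  \<comment> \<open>At most two transpositions carry the base curvatures (0, 0, 1, 1) to any
    placement of the two zeros; the pair \<open>1 1\<close> stands for the identity.\<close>
  have transp: ?thesis
    if "\<forall>x. real_of_int (v x) = h * W_D1 $ Transposition.transpose i j (Transposition.transpose k l x) $ 2"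
    for i j k l
    using that
    by (intro exI[of _ "Transposition.transpose i j \<circ> Transposition.transpose k l"] exI[of _ h])
      (simp add: bij_comp)
  consider "v 1 = 0" "v 2 = 0" "v 3 = h" "v 4 = h" | "v 1 = h" "v 2 = h" "v 3 = 0" "v 4 = 0"
    | "v 1 = h" "v 2 = 0" "v 3 = h" "v 4 = 0" | "v 1 = h" "v 2 = 0" "v 3 = 0" "v 4 = h"
    | "v 1 = 0" "v 2 = h" "v 3 = h" "v 4 = 0" | "v 1 = 0" "v 2 = h" "v 3 = 0" "v 4 = h"
    using vals[of 1] vals[of 2] vals[of 3] vals[of 4] s h \<open>h > 0\<close> by smt
  then show ?thesis
  proof cases
    case 1
    then show ?thesis
      by (intro transp[of 1 1 1 1]) (simp add: forall_4 W_D1_def Transposition.transpose_def)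
  next
    case 2
    then show ?thesis
      by (intro transp[of 1 3 2 4]) (simp add: forall_4 W_D1_def Transposition.transpose_def)
  next
    case 3
    then show ?thesis
      by (intro transp[of 1 4 1 1]) (simp add: forall_4 W_D1_def Transposition.transpose_def)
  next
    case 4
    then show ?thesis
      by (intro transp[of 1 3 1 1]) (simp add: forall_4 W_D1_def Transposition.transpose_def)
  next
    case 5
    then show ?thesis
      by (intro transp[of 2 4 1 1]) (simp add: forall_4 W_D1_def Transposition.transpose_def)
  next
    case 6
    then show ?thesis
      by (intro transp[of 2 3 1 1]) (simp add: forall_4 W_D1_def Transposition.transpose_def)
  qed
qed

text \<open>Descent on the absolute value of the sum s. The move \<open>S_mat i\<close> changes s to
  3 s - 4 w_i, which is smaller if s/2 < w_i < s; its transpose gives s + 4 w_i, smaller if -s/2 <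
  w_i < 0. Since the moves are involutions, applying the same move to the matrix found for the
  smaller vector recovers the original one.\<close>

lemma null_vector_multiple_of_orbit_curvatures:
  fixes v :: "4 \<Rightarrow> int"
  assumes "2 * (\<Sum>i\<in>UNIV. (v i)\<^sup>2) = (\<Sum>i\<in>UNIV. v i)\<^sup>2"
  shows "\<exists>M\<in>orbit. \<exists>g::int. \<forall>i. real_of_int (v i) = g * M $ i $ 2"
  using assms
proof (induction "nat \<bar>\<Sum>i\<in>UNIV. v i\<bar>" arbitrary: v rule: less_induct)
  case less
  \<comment> \<open>Stated for every \<open>w\<close> with the same absolute sum, so that it serves
    both for \<open>v\<close> and for its negative.\<close>
  have nonneg: "\<exists>M\<in>orbit. \<exists>g::int. \<forall>i. real_of_int (w i) = g * M $ i $ 2"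
    if null: "2 * (\<Sum>i\<in>UNIV. (w i)\<^sup>2) = (\<Sum>i\<in>UNIV. w i)\<^sup>2"
      and abs: "\<bar>\<Sum>i\<in>UNIV. w i\<bar> = \<bar>\<Sum>i\<in>UNIV. v i\<bar>" and "(\<Sum>i\<in>UNIV. w i) \<ge> 0" for w
  proof -
    define s where "s = (\<Sum>i\<in>UNIV. w i)"
    have IH: "\<exists>M\<in>orbit. \<exists>g::int. \<forall>i. real_of_int (u i) = g * M $ i $ 2"
      if "\<bar>\<Sum>i\<in>UNIV. u i\<bar> < s" "2 * (\<Sum>i\<in>UNIV. (u i)\<^sup>2) = (\<Sum>i\<in>UNIV. u i)\<^sup>2" for u
      using less.hyps[of u] that abs \<open>(\<Sum>i\<in>UNIV. w i) \<ge> 0\<close> by (simp add: s_def)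
    have sq_le: "2 * (w i)\<^sup>2 \<le> s\<^sup>2" for i
      using member_le_sum[of i UNIV "\<lambda>i. (w i)\<^sup>2"] null by (simp add: s_def)
    have "s \<ge> 0" using that by (simp add: s_def)
    then consider "s = 0" | i where "s > 0" "2 * w i > s" | i where "s > 0" "w i < 0" "- s < 2 * w i"
      | "s > 0" "\<And>i. 2 * w i \<le> s" "\<And>i. w i < 0 \<Longrightarrow> 2 * w i \<le> - s"
      by (meson linorder_not_less order_le_less)
    then show ?thesis
    proof cases
      case 1
      then have "w i = 0" for i using sq_le[of i] by simp
      then show ?thesis
        by (intro bexI[OF _ orbit.base] exI[of _ 0]) simp
    next
      case 2
      have "w i < s"
      proof (rule ccontr)
        assume "\<not> w i < s"
        then have "s\<^sup>2 \<le> (w i)\<^sup>2" using \<open>s \<ge> 0\<close> by (intro power_mono) auto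
        with sq_le[of i] \<open>s > 0\<close> show False
          using zero_less_power[OF \<open>s > 0\<close>, of 2] by linarith
      qed
      define u where "u = w(i := 2 * s - 3 * w i)"
      have sum_u: "(\<Sum>i\<in>UNIV. u i) = 3 * s - 4 * w i"
        unfolding u_def sum_fun_upd by (simp add: s_def)
      have "(\<lambda>j. (u j)\<^sup>2) = (\<lambda>j. (w j)\<^sup>2)(i := (2 * s - 3 * w i)\<^sup>2)"
        by (auto simp: u_def)
      then have "(\<Sum>j\<in>UNIV. (u j)\<^sup>2) = (\<Sum>j\<in>UNIV. (w j)\<^sup>2) - (w i)\<^sup>2 + (2 * s - 3 * w i)\<^sup>2"
        by (simp only: sum_fun_upd)
      then have "2 * (\<Sum>j\<in>UNIV. (u j)\<^sup>2) = s\<^sup>2 - 2 * (w i)\<^sup>2 + 2 * (2 * s - 3 * w i)\<^sup>2"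
        using null by (simp add: s_def)
      also have "\<dots> = (3 * s - 4 * w i)\<^sup>2"
        by (simp add: power2_eq_square algebra_simps)
      finally have "2 * (\<Sum>j\<in>UNIV. (u j)\<^sup>2) = (\<Sum>i\<in>UNIV. u i)\<^sup>2" by (simp add: sum_u)
      moreover have "\<bar>\<Sum>i\<in>UNIV. u i\<bar> < s"
        unfolding sum_u using 2 \<open>w i < s\<close> by linarith
      ultimately obtain M and g :: int where M: "M \<in> orbit" "\<forall>j. real_of_int (u j) = g * M $ j $ 2"
        using IH by blast
      have "real_of_int (w j) = g * (S_mat i ** M) $ j $ 2" for j
      proof (cases "j = i")
        case True
        have "g * (S_mat i ** M) $ i $ 2 = 2 * (\<Sum>k\<in>UNIV. g * M $ k $ 2) - 3 * (g * M $ i $ 2)"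
          by (simp add: S_mat_mult_row algebra_simps flip: sum_distrib_left)
        also have "\<dots> = real_of_int (2 * (\<Sum>k\<in>UNIV. u k) - 3 * u i)"
          using M(2) by simp
        also have "2 * (\<Sum>k\<in>UNIV. u k) - 3 * u i = w i"
          unfolding sum_u by (simp add: u_def)
        finally show ?thesis using True by simp
      next
        case False
        have "real_of_int (u j) = g * M $ j $ 2" using M(2) by blast
        with False show ?thesis by (simp add: S_mat_mult_row u_def)
      qed
      with orbit.S[OF M(1)] show ?thesis by blast
    next
      case 3
      define u where "u = (\<lambda>j. w j + 2 * w i)(i := - w i)"
      have "(\<Sum>j\<in>UNIV. w j + 2 * w i) = s + 8 * w i"
        by (simp add: s_def sum.distrib)
      then have sum_u: "(\<Sum>i\<in>UNIV. u i) = s + 4 * w i"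
        unfolding u_def sum_fun_upd by simp
      have "(\<Sum>j\<in>UNIV. (w j + 2 * w i)\<^sup>2) = (\<Sum>j\<in>UNIV. (w j)\<^sup>2) + 4 * w i * s + 16 * (w i)\<^sup>2"
        by (simp add: s_def sum_4 power2_eq_square algebra_simps)
      moreover have "(\<lambda>j. (u j)\<^sup>2) = (\<lambda>j. (w j + 2 * w i)\<^sup>2)(i := (w i)\<^sup>2)"
        by (auto simp: u_def)
      then have "(\<Sum>j\<in>UNIV. (u j)\<^sup>2) = (\<Sum>j\<in>UNIV. (w j + 2 * w i)\<^sup>2) - (w i + 2 * w i)\<^sup>2 + (w i)\<^sup>2"
        by (simp only: sum_fun_upd)
      ultimately have "2 * (\<Sum>j\<in>UNIV. (u j)\<^sup>2)
          = s\<^sup>2 + 8 * w i * s + 32 * (w i)\<^sup>2 - 2 * (w i + 2 * w i)\<^sup>2 + 2 * (w i)\<^sup>2"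
        using null by (simp add: s_def)
      also have "\<dots> = (s + 4 * w i)\<^sup>2"
        by (simp add: power2_eq_square algebra_simps)
      finally have "2 * (\<Sum>j\<in>UNIV. (u j)\<^sup>2) = (\<Sum>i\<in>UNIV. u i)\<^sup>2" by (simp add: sum_u)
      moreover have "\<bar>\<Sum>i\<in>UNIV. u i\<bar> < s"
        unfolding sum_u using 3 by linarith
      ultimately obtain M and g :: int where M: "M \<in> orbit" "\<forall>j. real_of_int (u j) = g * M $ j $ 2"
        using IH by blast
      have u: "real_of_int (u j) = g * M $ j $ 2" for j using M(2) by blast
      have "real_of_int (w j) = g * (transpose (S_mat i) ** M) $ j $ 2" for j
        using u[of i] u[of j] by (auto simp: transpose_S_mat_mult_row u_def algebra_simps split: if_splits)
      with orbit.ST[OF M(1)] show ?thesis by blast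
    next
      case 4
      then obtain \<pi> h where "bij \<pi>" "\<forall>i. real_of_int (w i) = real_of_int h * W_D1 $ \<pi> i $ 2"
        using reduced_null_vector[OF null] unfolding s_def by metis
      then show ?thesis
        by (intro bexI[OF _ orbit.perm[OF orbit.base]] exI[of _ h]) auto
    qed
  qed
  show ?case
  proof (cases "(\<Sum>i\<in>UNIV. v i) \<ge> 0")
    case True
    with nonneg less.prems show ?thesis by blast
  next
    case False
    then obtain M and g :: int where M: "M \<in> orbit" "\<forall>i. real_of_int (- v i) = g * M $ i $ 2"
      using nonneg[of "\<lambda>i. - v i"] less.prems by (auto simp: sum_negf)
    then show ?thesis
      by (intro bexI[OF _ M(1)] exI[of _ "- g"]) (simp add: minus_equation_iff[of "real_of_int _"] eq_commute)
  qed
qed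

subsection \<open>Configurations with equal curvatures\<close>

text \<open>The Gram and lattice conditions survive the moves, so \<open>N\<close> can follow
  \<open>M\<close> back to the base configuration. The asserted relation between the rows is linear,
  with the same coefficients for all rows, and is thus carried forward again.\<close>

lemma orbit_determined_by_curvatures:
  assumes "M \<in> orbit" and "gram N" and "\<And>i. N $ i \<in> row_lattice" and "\<And>i. N $ i $ 2 = M $ i $ 2"
  shows "\<exists>\<sigma>\<in>{1, -1}. \<exists>\<tau>\<in>{1, -1}. \<exists>s t :: int. \<forall>i.
           N $ i $ 3 = \<sigma> * M $ i $ 3 + 2 * of_int s * M $ i $ 2 \<and>
           N $ i $ 4 = \<tau> * M $ i $ 4 + 2 * of_int t * M $ i $ 2"
  using assms
proof (induction arbitrary: N rule: orbit.induct)
  case base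
  have ip: "ip (N $ i) (N $ j) = (if i = j then 1 else -1)" for i j
    using base(1) by (simp add: gram_def)
  have curv: "N $ 1 $ 2 = 0" "N $ 2 $ 2 = 0" "N $ 3 $ 2 = 1" "N $ 4 $ 2 = 1"
    using base(3) by (simp_all add: W_D1_def)
  obtain b1 n1 s1 p1 :: int where 1: "N $ 1 $ 1 = 2 * of_int n1 + 4 * of_int p1" "N $ 1 $ 2 = of_int b1"
      "N $ 1 $ 3 = of_int b1 + 2 * of_int s1" "N $ 1 $ 4 = of_int n1"
    using row_latticeE[OF base(2)[of 1]] by metis
  obtain b2 n2 s2 p2 :: int where 2: "N $ 2 $ 1 = 2 * of_int n2 + 4 * of_int p2" "N $ 2 $ 2 = of_int b2"
      "N $ 2 $ 3 = of_int b2 + 2 * of_int s2" "N $ 2 $ 4 = of_int n2"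
    using row_latticeE[OF base(2)[of 2]] by metis
  obtain b3 n3 s3 p3 :: int where 3: "N $ 3 $ 1 = 2 * of_int n3 + 4 * of_int p3" "N $ 3 $ 2 = of_int b3"
      "N $ 3 $ 3 = of_int b3 + 2 * of_int s3" "N $ 3 $ 4 = of_int n3"
    using row_latticeE[OF base(2)[of 3]] by metis
  obtain b4 n4 s4 p4 :: int where 4: "N $ 4 $ 1 = 2 * of_int n4 + 4 * of_int p4" "N $ 4 $ 2 = of_int b4"
      "N $ 4 $ 3 = of_int b4 + 2 * of_int s4" "N $ 4 $ 4 = of_int n4"
    using row_latticeE[OF base(2)[of 4]] by metis
  have b: "b1 = 0" "b2 = 0" "b3 = 1" "b4 = 1"
    using curv 1(2) 2(2) 3(2) 4(2) by simp_all
  \<comment> \<open>For a row of curvature 0, square one is an equation in the integer lattice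
    coordinates that leaves only the horizontal lines.\<close>
  have unit: "n = 1 \<or> n = -1" "s = 0" if "(2 * real_of_int s) * (2 * real_of_int s) + real_of_int n * real_of_int n = 1"
    for s n :: int
  proof -
    have "real_of_int (4 * (s * s) + n * n) = of_int 1"
      using that by simp
    then have eq: "4 * (s * s) + n * n = 1"
      by (simp only: of_int_eq_iff)
    have "s * s \<ge> 0" "n * n \<ge> 0" by simp_all
    with eq have "s * s = 0" by linarith
    with eq show "s = 0" "n = 1 \<or> n = -1"
      by (auto simp: square_eq_1_iff)
  qed
  have n1: "n1 = 1 \<or> n1 = -1" "s1 = 0"
    using unit[of s1 n1] ip[of 1 1] 1 b by (simp_all add: ip_def)
  have s2: "s2 = 0"
    using unit[of s2 n2] ip[of 2 2] 2 b by (simp_all add: ip_def)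
  have "real_of_int (n1 * n2) = of_int (-1)"
    using ip[of 1 2] 1 2 b n1 s2 by (simp add: ip_def)
  then have "n1 * n2 = -1" by (simp only: of_int_eq_iff)
  then have n2: "n2 = - n1" using n1 by auto
  have "real_of_int (n1 * n3 - n1 - 2 * p1) = of_int (-1)"
    using ip[of 1 3] 1 3 b n1 by (simp add: ip_def add_divide_distrib)
  then have n3: "n1 * n3 - n1 - 2 * p1 = -1" by (simp only: of_int_eq_iff)
  have "real_of_int (n1 * n4 - n1 - 2 * p1) = of_int (-1)"
    using ip[of 1 4] 1 4 b n1 by (simp add: ip_def add_divide_distrib)
  then have "n1 * n4 - n1 - 2 * p1 = -1" by (simp only: of_int_eq_iff)
  with n3 n1 have n4: "n4 = n3" by auto
  \<comment> \<open>\<open>n3\<close> is the height of the unit circles; its parity is what makes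
    the vertical translation an even integer.\<close>
  have "even n3"
    using n1(1)
  proof
    assume "n1 = 1"
    with n3 have "n3 = 2 * p1" by simp
    then show ?thesis by simp
  next
    assume "n1 = -1"
    with n3 have "n3 = 2 - 2 * p1" by simp
    then show ?thesis by simp
  qed
  then obtain t where t: "n3 = 2 * t" by blast
  \<comment> \<open>Half the difference of the x-coordinates of the two unit centers. Tangency at
    equal height makes it 1 or -1, and its being odd makes the midpoint 1 + s3 + s4 even.\<close>
  define d where "d = s3 - s4"
  have "(2 * real_of_int d) * (2 * real_of_int d) = 4"
    using ip[of 3 3] ip[of 4 4] ip[of 3 4] 3 4 b n4 by (simp add: ip_def d_def algebra_simps)
  then have "real_of_int (d * d) = of_int 1" by simp
  then have "d * d = 1" by (simp only: of_int_eq_iff)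
  then have d: "d = 1 \<or> d = -1" by (simp add: square_eq_1_iff)
  then have "even (1 + s3 + s4)" unfolding d_def by presburger
  then obtain s where s: "1 + s3 + s4 = 2 * s" by blast
  have s3: "2 * s3 + 1 = d + 2 * s" and s4: "2 * s4 + 1 = 2 * s - d"
    using s by (simp_all add: d_def)
  have "1 + 2 * real_of_int s3 = of_int d + 2 * of_int s" "1 + 2 * real_of_int s4 = 2 * of_int s - of_int d"
    using s3[THEN arg_cong, of real_of_int] s4[THEN arg_cong, of real_of_int] by simp_all
  \<comment> \<open>\<open>d\<close> tells whether row 3 is the right or the left unit circle,
    \<open>n1\<close> whether the normal in row 1 points up or down; these are the two
    signs.\<close>
  with d n1 show ?case
    by (intro bexI[of _ "of_int d"] bexI[of _ "of_int n1"] exI[of _ s] exI[of _ t])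
      (auto simp: forall_4 W_D1_def 1 2 3 4 b n2 n4 s2 t)
next
  case (S M j)
  \<comment> \<open>As the move is an involution, applying it to \<open>N\<close> gives the
    curvatures of \<open>M\<close>, so the induction hypothesis applies there.\<close>
  have "(S_mat j ** N) $ i $ 2 = M $ i $ 2" for i
  proof -
    have "(S_mat j ** N) $ i $ 2 = (S_mat j ** (S_mat j ** M)) $ i $ 2"
      by (simp add: S_mat_mult_row[of j N] S_mat_mult_row[of j "S_mat j ** M"] S.prems(3))
    then show ?thesis by (simp add: S_mat_involution)
  qed
  from S.IH[OF gram_S[OF S.prems(1)] row_lattice_S[OF S.prems(2)] this]
  obtain \<sigma> \<tau> :: real and s t :: int where *: "\<sigma> \<in> {1, -1}" "\<tau> \<in> {1, -1}"
    "\<And>i. (S_mat j ** N) $ i $ 3 = \<sigma> * M $ i $ 3 + 2 * of_int s * M $ i $ 2"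
    "\<And>i. (S_mat j ** N) $ i $ 4 = \<tau> * M $ i $ 4 + 2 * of_int t * M $ i $ 2"
    by metis
  have "N $ i $ 3 = \<sigma> * (S_mat j ** M) $ i $ 3 + 2 * of_int s * (S_mat j ** M) $ i $ 2 \<and>
        N $ i $ 4 = \<tau> * (S_mat j ** M) $ i $ 4 + 2 * of_int t * (S_mat j ** M) $ i $ 2" for i
    by (subst (1 2) S_mat_involution[of j N, symmetric],
        simp add: S_mat_mult_row[of j "S_mat j ** N"] S_mat_mult_row[of j M] *(3,4) sum_4 algebra_simps)
  with *(1,2) show ?case by blast
next
  case (ST M j)
  let ?T = "transpose (S_mat j)"
  have "(?T ** N) $ i $ 2 = M $ i $ 2" for i
  proof -
    have "(?T ** N) $ i $ 2 = (?T ** (?T ** M)) $ i $ 2"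
      by (simp add: transpose_S_mat_mult_row[of j N] transpose_S_mat_mult_row[of j "?T ** M"] ST.prems(3))
    then show ?thesis by (simp add: transpose_S_mat_involution)
  qed
  from ST.IH[OF gram_ST[OF ST.prems(1)] row_lattice_ST[OF ST.prems(2)] this]
  obtain \<sigma> \<tau> :: real and s t :: int where *: "\<sigma> \<in> {1, -1}" "\<tau> \<in> {1, -1}"
    "\<And>i. (?T ** N) $ i $ 3 = \<sigma> * M $ i $ 3 + 2 * of_int s * M $ i $ 2"
    "\<And>i. (?T ** N) $ i $ 4 = \<tau> * M $ i $ 4 + 2 * of_int t * M $ i $ 2"
    by metis
  have "N $ i $ 3 = \<sigma> * (?T ** M) $ i $ 3 + 2 * of_int s * (?T ** M) $ i $ 2 \<and>
        N $ i $ 4 = \<tau> * (?T ** M) $ i $ 4 + 2 * of_int t * (?T ** M) $ i $ 2" for i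
    by (subst (1 2) transpose_S_mat_involution[of j N, symmetric],
        simp add: transpose_S_mat_mult_row[of j "?T ** N"] transpose_S_mat_mult_row[of j M] *(3,4) algebra_simps)
  with *(1,2) show ?case by blast
next
  case (perm M \<pi>)
  have \<pi>: "\<pi> (inv \<pi> i) = i" for i
    using perm.hyps(2) by (simp add: bij_is_surj surj_f_inv_f)
  have "gram (permute_rows (inv \<pi>) N)"
    using perm.prems(1) perm.hyps(2) by (intro gram_permute_rows bij_imp_bij_inv)
  moreover have "permute_rows (inv \<pi>) N $ i \<in> row_lattice" for i
    using perm.prems(2) by simp
  moreover have "permute_rows (inv \<pi>) N $ i $ 2 = M $ i $ 2" for i
    by (simp add: perm.prems(3) \<pi>)
  ultimately obtain \<sigma> \<tau> :: real and s t :: int where *: "\<sigma> \<in> {1, -1}" "\<tau> \<in> {1, -1}"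
    "\<And>i. permute_rows (inv \<pi>) N $ i $ 3 = \<sigma> * M $ i $ 3 + 2 * of_int s * M $ i $ 2"
    "\<And>i. permute_rows (inv \<pi>) N $ i $ 4 = \<tau> * M $ i $ 4 + 2 * of_int t * M $ i $ 2"
    using perm.IH[of "permute_rows (inv \<pi>) N"] by metis
  have "N $ i $ 3 = \<sigma> * permute_rows \<pi> M $ i $ 3 + 2 * of_int s * permute_rows \<pi> M $ i $ 2 \<and>
        N $ i $ 4 = \<tau> * permute_rows \<pi> M $ i $ 4 + 2 * of_int t * permute_rows \<pi> M $ i $ 2" for i
    using *(3)[of "\<pi> i"] *(4)[of "\<pi> i"] perm.hyps(2) by (simp add: bij_is_inj)
  with *(1,2) show ?case by blast
qed

subsection \<open>Gram matrices and tangent circles\<close>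

text \<open>Inverting \<open>M A M\<^sup>T = N\<close>, with \<open>A\<close> the matrix of \<open>ip\<close> and \<open>N\<close> the Gram matrix, gives
  \<open>M\<^sup>T N\<inverse> M = A\<inverse>\<close>, whose entry \<open>(2, 2)\<close> is the Descartes relation.\<close>
lemma gram_imp_descartes_relation:
  assumes "gram M"
  shows "2 * (\<Sum>i\<in>UNIV. (M $ i $ 2)\<^sup>2) = (\<Sum>i\<in>UNIV. M $ i $ 2)\<^sup>2"
proof -
  define A A' N' N :: "real^4^4" where
    "A = vector [vector [0, -1/2, 0, 0], vector [-1/2, 0, 0, 0], vector [0, 0, 1, 0], vector [0, 0, 0, 1]]"
    and "A' = vector [vector [0, -2, 0, 0], vector [-2, 0, 0, 0], vector [0, 0, 1, 0], vector [0, 0, 0, 1]]"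
    and "N' = (\<chi> i j. if i = j then 1/4 else -1/4)"
    and "N = (\<chi> i j. if i = j then 1 else -1)"
  have "A ** A' = mat 1"
    by (simp add: A_def A'_def vec_eq_iff forall_4 matrix_matrix_mult_def sum_4 mat_def)
  moreover have "N' ** N = mat 1"
    by (simp add: N_def N'_def vec_eq_iff forall_4 matrix_matrix_mult_def sum_4 mat_def)
  moreover have "M ** A ** transpose M = N"
  proof -
    have "(M ** A ** transpose M) $ i $ j = ip (M $ i) (M $ j)" for i j
      by (simp add: ip_def A_def matrix_matrix_mult_def transpose_def sum_4 field_simps)
    then show ?thesis
      using assms by (simp add: vec_eq_iff gram_def N_def)
  qed
  ultimately have "(N' ** M ** A) ** transpose M = mat 1"
    by (simp flip: matrix_mul_assoc)
  then have "transpose M ** (N' ** M ** A) = mat 1"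
    using matrix_left_right_inverse by blast
  then have "transpose M ** (N' ** M ** A) ** A' = A'"
    by simp
  then have "transpose M ** N' ** M = A'"
    using \<open>A ** A' = mat 1\<close> by (simp flip: matrix_mul_assoc)
  then have "(transpose M ** N' ** M) $ 2 $ 2 = 0"
    by (simp add: A'_def)
  then show ?thesis
    by (simp add: N'_def matrix_matrix_mult_def transpose_def sum_4 power2_eq_square algebra_simps)
qed

lemma ip_wrow_Circ:
  assumes "k \<noteq> 0" "l \<noteq> 0"
  shows "ip (wrow (Circ a k)) (wrow (Circ b l)) = (k / l + l / k - k * l * (dist a b)\<^sup>2) / 2"
  using assms
  by (simp add: ip_def dist_norm cmod_power2 field_simps) (simp add: power2_eq_square algebra_simps)

text \<open>With signed radii one formula covers both kinds of tangency: for opposite signs,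
  \<bar>1/k + 1/l\<bar> is the difference of the radii.\<close>

lemma ip_wrow_Circ_eq_minus_1:
  assumes "k \<noteq> 0" "l \<noteq> 0"
  shows "ip (wrow (Circ a k)) (wrow (Circ b l)) = -1 \<longleftrightarrow> dist a b = \<bar>1 / k + 1 / l\<bar>"
proof -
  have "ip (wrow (Circ a k)) (wrow (Circ b l)) = -1 \<longleftrightarrow> (dist a b)\<^sup>2 = (1 / k + 1 / l)\<^sup>2"
    unfolding ip_wrow_Circ[OF assms] using assms
    by (simp add: field_simps power2_eq_square) (auto simp: algebra_simps)
  also have "\<dots> \<longleftrightarrow> \<bar>dist a b\<bar> = \<bar>1 / k + 1 / l\<bar>"
    by (simp only: abs_eq_iff power2_eq_iff)
  finally show ?thesis by simp
qed

text \<open>The contact point divides the segment of the centers in the signed ratio p : q. For any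
  other common point the inner product with b - a is prescribed, and its squared distance to the
  contact point expands to 0.\<close>

lemma spheres_meet_once:
  fixes a b :: "'a::real_inner"
  assumes "dist a b = \<bar>p + q\<bar>" and "p + q \<noteq> 0"
  shows "\<exists>!z. z \<in> sphere a \<bar>p\<bar> \<inter> sphere b \<bar>q\<bar>"
proof
  define z where "z = a + (p / (p + q)) *\<^sub>R (b - a)"
  have "norm (b - a) = \<bar>p + q\<bar>"
    using assms(1) by (simp add: dist_norm norm_minus_commute)
  moreover have "z - a = (p / (p + q)) *\<^sub>R (b - a)"
    by (simp add: z_def)
  moreover have "z - b = (- q / (p + q)) *\<^sub>R (b - a)"
  proof -
    have "z - b = (p / (p + q) - 1) *\<^sub>R (b - a)"
      by (simp add: z_def algebra_simps)
    also have "p / (p + q) - 1 = - q / (p + q)"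
      using assms(2) by (simp add: field_simps)
    finally show ?thesis .
  qed
  ultimately have "dist a z = \<bar>p / (p + q)\<bar> * \<bar>p + q\<bar>" "dist b z = \<bar>- q / (p + q)\<bar> * \<bar>p + q\<bar>"
    by (metis dist_commute dist_norm norm_scaleR)+
  then show "z \<in> sphere a \<bar>p\<bar> \<inter> sphere b \<bar>q\<bar>"
    using assms(2) by simp
  fix y
  assume "y \<in> sphere a \<bar>p\<bar> \<inter> sphere b \<bar>q\<bar>"
  then have "norm (y - a) = \<bar>p\<bar>" "norm (y - b) = \<bar>q\<bar>"
    by (simp_all add: dist_norm norm_minus_commute)
  moreover define u w where "u = y - a" and "w = b - a"
  then have "y - a = u" "y - b = u - w" "b - a = w" by simp_all
  ultimately have "norm u = \<bar>p\<bar>" "norm (u - w) = \<bar>q\<bar>" "norm w = \<bar>p + q\<bar>"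
    using \<open>norm (b - a) = \<bar>p + q\<bar>\<close> by simp_all
  then have "(norm u)\<^sup>2 = p\<^sup>2" "(norm (u - w))\<^sup>2 = q\<^sup>2" and "(norm w)\<^sup>2 = (p + q)\<^sup>2"
    by simp_all
  then have u: "u \<bullet> u = p\<^sup>2" and uw: "2 * (u \<bullet> w) = 2 * p * (p + q)" and w: "w \<bullet> w = (p + q)\<^sup>2"
    unfolding power2_norm_eq_inner inner_diff_left inner_diff_right inner_commute[of w u]
    by (simp_all add: power2_eq_square algebra_simps)
  from uw have uw: "u \<bullet> w = p * (p + q)" by simp
  define c where "c = p / (p + q)"
  have c: "c * (p + q) = p" using assms(2) by (simp add: c_def)
  have "y - z = u - c *\<^sub>R w"
    by (simp add: z_def u_def w_def c_def)
  then have "(y - z) \<bullet> (y - z) = u \<bullet> u - 2 * c * (u \<bullet> w) + c * c * (w \<bullet> w)"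
    by (simp add: inner_diff_left inner_diff_right inner_commute[of w u]) (simp add: algebra_simps)
  also have "\<dots> = (p - c * (p + q))\<^sup>2"
    unfolding u uw w by (simp add: power2_eq_square algebra_simps)
  finally show "y = z" by (simp add: c)
qed

text \<open>Otherwise the point dividing the segment of the centers in the ratio r : s lies in both
  balls.\<close>

lemma disjoint_balls_imp_dist_ge:
  fixes a b :: "'a::real_normed_vector"
  assumes "ball a r \<inter> ball b s = {}" "r > 0" "s > 0"
  shows "r + s \<le> dist a b"
proof (rule ccontr)
  assume *: "\<not> r + s \<le> dist a b"
  define z where "z = a + (r / (r + s)) *\<^sub>R (b - a)"
  have "z - a = (r / (r + s)) *\<^sub>R (b - a)"
    by (simp add: z_def)
  moreover have "z - b = (- s / (r + s)) *\<^sub>R (b - a)"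
  proof -
    have "z - b = (r / (r + s) - 1) *\<^sub>R (b - a)"
      by (simp add: z_def algebra_simps)
    also have "r / (r + s) - 1 = - s / (r + s)"
      using assms(2,3) by (simp add: field_simps)
    finally show ?thesis .
  qed
  ultimately have "dist a z = \<bar>r / (r + s)\<bar> * dist a b" "dist b z = \<bar>- s / (r + s)\<bar> * dist a b"
    by (metis dist_commute dist_norm norm_scaleR)+
  moreover have "r * dist a b < r * (r + s)" "s * dist a b < s * (r + s)"
    using * assms(2,3) by simp_all
  ultimately have "z \<in> ball a r \<inter> ball b s"
    using assms(2,3) by (simp add: pos_divide_less_eq)
  with assms(1) show False by blast
qed

text \<open>Disjointness bounds the distance of the centers on one side, a common point on the
  other. For k < 0, disjointness means that the disk of \<open>b\<close> lies in the closed disk of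
  \<open>a\<close>, and k + l > 0 says that it is strictly smaller.\<close>

lemma disjoint_tangent_circles_iff_pos:
  assumes "k \<noteq> 0" "l > 0"
  shows "cinterior (Circ a k) \<inter> cinterior (Circ b l) = {} \<and> tangent (Circ a k) (Circ b l)
     \<longleftrightarrow> k + l > 0 \<and> dist a b = \<bar>1 / k + 1 / l\<bar>" (is "?lhs \<longleftrightarrow> ?rhs")
proof (cases "k > 0")
  case True
  then have pos: "1 / k + 1 / l > 0"
    using assms(2) by (simp add: add_pos_pos)
  show ?thesis
  proof
    assume ?lhs
    then have "1 / k + 1 / l \<le> dist a b"
      using True assms(2) by (intro disjoint_balls_imp_dist_ge) auto
    moreover obtain z where "dist a z = 1 / k" "dist b z = 1 / l"
      using \<open>?lhs\<close> True assms(2) by (auto simp: tangent_def)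
    then have "dist a b \<le> 1 / k + 1 / l"
      using dist_triangle2[of a b z] by simp
    ultimately show ?rhs using True assms(2) pos by simp
  next
    assume ?rhs
    then have "dist a b = 1 / k + 1 / l" using pos by simp
    with spheres_meet_once[of a b "1 / k" "1 / l"] True assms(2) show ?lhs
      by (auto simp: tangent_def disjoint_ballI add_pos_pos less_imp_neq[symmetric])
  qed
next
  case False
  then have k: "k < 0" using assms(1) by simp
  then have disjoint: "cinterior (Circ a k) \<inter> cinterior (Circ b l) = {} \<longleftrightarrow> ball b (1 / l) \<subseteq> cball a (1 / \<bar>k\<bar>)"
    using assms(2) by auto
  also have "\<dots> \<longleftrightarrow> dist a b + 1 / l \<le> - 1 / k"
    using assms(2) k by (simp add: ball_subset_cball_iff dist_commute)
  finally have disjoint: "cinterior (Circ a k) \<inter> cinterior (Circ b l) = {} \<longleftrightarrow> dist a b + 1 / l \<le> - 1 / k" .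
  have sum_pos: "k + l > 0 \<longleftrightarrow> 1 / l < - 1 / k"
    using k assms(2) by (auto simp: field_simps)
  show ?thesis
  proof
    assume ?lhs
    then have le: "dist a b + 1 / l \<le> - 1 / k" using disjoint by simp
    have ex1: "\<exists>!z. z \<in> sphere a (- 1 / k) \<inter> sphere b (1 / l)"
      using \<open>?lhs\<close> k assms(2) by (simp add: tangent_def)
    then obtain z where "dist a z = - 1 / k" "dist b z = 1 / l"
      by auto
    then have "- 1 / k \<le> dist a b + 1 / l"
      using dist_triangle[of a z b] by simp
    with le have eq: "dist a b + 1 / l = - 1 / k" by simp
    \<comment> \<open>Concentric circles would coincide here and share two antipodal points.\<close>
    have "a \<noteq> b"
    proof
      assume "a = b"
      with eq have "a + of_real (1 / l) \<in> sphere a (- 1 / k) \<inter> sphere b (1 / l)"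
          "a - of_real (1 / l) \<in> sphere a (- 1 / k) \<inter> sphere b (1 / l)"
        using assms(2) k by (simp_all add: dist_norm norm_divide)
      with ex1 have "a + of_real (1 / l) = a - of_real (1 / l)" by blast
      with assms(2) show False by (simp add: complex_eq_iff)
    qed
    with eq have "1 / l < - 1 / k" by (metis less_add_same_cancel2 zero_less_dist_iff)
    with eq sum_pos show ?rhs by simp
  next
    assume ?rhs
    with sum_pos have "1 / l < - 1 / k" "dist a b = - 1 / k - 1 / l" by simp_all
    with spheres_meet_once[of a b "1 / k" "1 / l"] disjoint k assms(2) show ?lhs
      by (auto simp: tangent_def)
  qed
qed

lemma tangent_commute: "tangent C D \<longleftrightarrow> tangent D C"
  by (auto simp: tangent_def Int_commute conj_commute)

lemma disjoint_tangent_circles_iff: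
  assumes "k \<noteq> 0" "l \<noteq> 0"
  shows "cinterior (Circ a k) \<inter> cinterior (Circ b l) = {} \<and> tangent (Circ a k) (Circ b l)
     \<longleftrightarrow> k + l > 0 \<and> ip (wrow (Circ a k)) (wrow (Circ b l)) = -1"
proof -
  consider "l > 0" | "k > 0" | "k < 0" "l < 0" using assms by linarith
  then show ?thesis
  proof cases
    case 1
    with assms show ?thesis
      unfolding ip_wrow_Circ_eq_minus_1[OF assms] by (intro disjoint_tangent_circles_iff_pos)
  next
    case 2
    from disjoint_tangent_circles_iff_pos[OF assms(2) 2, of b a] show ?thesis
      unfolding ip_wrow_Circ_eq_minus_1[OF assms]
      by (simp only: Int_commute tangent_commute dist_commute add.commute)
  next
    \<comment> \<open>The complements of two disks always meet, so both sides are false.\<close>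
    case 3
    have "bounded (cball a (1 / \<bar>k\<bar>) \<union> cball b (1 / \<bar>l\<bar>))" by simp
    then have "cball a (1 / \<bar>k\<bar>) \<union> cball b (1 / \<bar>l\<bar>) \<noteq> UNIV"
      using not_bounded_UNIV by metis
    with 3 show ?thesis by auto
  qed
qed

text \<open>The Gram matrix is unchanged when all rows are negated; positive curvature sums select
  the orientation with disjoint interiors.\<close>

lemma descartes_iff_gram:
  assumes "\<And>i. curv (C i) \<noteq> 0"
  shows "descartes C \<longleftrightarrow> gram (Wmat C) \<and> (\<forall>i j. i \<noteq> j \<longrightarrow> curv (C i) + curv (C j) > 0)"
proof -
  have circ: "\<exists>a k. C i = Circ a k \<and> k \<noteq> 0" for i
    using assms[of i] by (cases "C i") auto
  have wf: "wf_circle (C i)" for i using circ[of i] by auto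
  have self: "ip (wrow (C i)) (wrow (C i)) = 1" for i
  proof -
    obtain a k where "C i = Circ a k" "k \<noteq> 0" using circ by blast
    with ip_wrow_Circ[of k k a a] show ?thesis by simp
  qed
  have "cinterior (C i) \<inter> cinterior (C j) = {} \<and> tangent (C i) (C j)
     \<longleftrightarrow> curv (C i) + curv (C j) > 0 \<and> ip (wrow (C i)) (wrow (C j)) = -1" for i j
  proof -
    obtain a k b l where "C i = Circ a k" "k \<noteq> 0" "C j = Circ b l" "l \<noteq> 0"
      using circ by metis
    then show ?thesis using disjoint_tangent_circles_iff[of k l a b] by simp
  qed
  then show ?thesis
    unfolding descartes_def gram_def Wmat_def by (auto simp: wf self)
qed

section \<open>Uniqueness of the center\<close>

text \<open>For \<sigma> = 1 the difference y - x = 2 s lies in [-1, 1]. For \<sigma> = -1 the sum x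
  + y = 2 s lies in [0, 2], and its even values 0 and 2 force both numbers to the same
  endpoint.\<close>

lemma unit_interval_reflection_unique:
  fixes x y :: real and s :: int
  assumes "\<sigma> \<in> {1, -1}" "y = \<sigma> * x + 2 * of_int s" "0 \<le> x" "x \<le> 1" "0 \<le> y" "y \<le> 1"
  shows "y = x"
proof (cases "\<sigma> = 1")
  case True
  with assms have "real_of_int s < 1" "real_of_int s > -1" by simp_all
  then have "s = 0" by linarith
  with True assms show ?thesis by simp
next
  case False
  with assms have "real_of_int s \<ge> 0" "real_of_int s \<le> 1" by simp_all
  then have "s = 0 \<or> s = 1" by linarith
  with False assms show ?thesis by auto
qed

lemma descartes_permute:
  assumes "descartes C" "bij \<pi>"
  shows "descartes (C \<circ> \<pi>)"
  using assms by (auto simp: descartes_def bij_is_inj inj_eq)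

lemma largest_circle_center_unique:
  assumes C: "descartes C" "in_super_orbit C" "\<And>i. curv (C i) \<noteq> 0"
      "largest_circle_center C z" "z \<in> unit_square"
    and D: "descartes D" "in_super_orbit D" "largest_circle_center D w" "w \<in> unit_square"
    and same: "curv_mset C = curv_mset D"
  shows "w = z"
proof -
  obtain i k where i: "C i = Circ z k" "\<And>j. \<bar>k\<bar> \<le> \<bar>curv (C j)\<bar>"
    using C(4) unfolding largest_circle_center_def by blast
  obtain j l where j: "D j = Circ w l" "\<And>i. \<bar>l\<bar> \<le> \<bar>curv (D i)\<bar>"
    using D(3) unfolding largest_circle_center_def by blast
  obtain \<pi> where "\<pi> permutes UNIV" and \<pi>: "\<forall>x\<in>UNIV. curv (C x) = curv (D (\<pi> x))"
    using image_mset_eq_implies_permutes[OF _ same[unfolded curv_mset_def]] by auto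
  then have "bij \<pi>" by (simp add: permutes_bij)
  have k: "k \<noteq> 0" using C(3)[of i] i by simp
  obtain j' where j': "\<pi> j' = j" using \<open>bij \<pi>\<close> by (metis bij_is_surj surjD)
  have "\<bar>k\<bar> = \<bar>l\<bar>"
    using i(2)[of j'] j(2)[of "\<pi> i"] \<pi>[THEN bspec, of j'] \<pi>[THEN bspec, of i] i(1) j(1) j' by simp
  \<comment> \<open>Rules out l = -k, which would make the curvatures of two different circles of
    \<open>C\<close> add up to 0.\<close>
  moreover have "curv (C i) + curv (C j') > 0" if "i \<noteq> j'"
    using C(1) that unfolding descartes_iff_gram[OF C(3)] by simp
  moreover have "curv (C i) = k" "curv (C j') = l"
    using i(1) j(1) j' \<pi>[THEN bspec, of j'] by simp_all
  ultimately have "k = l" by (cases "i = j'") auto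
  \<comment> \<open>Several circles may share the smallest absolute curvature, so the matching is
    corrected to pair the two chosen circles.\<close>
  define \<rho> where "\<rho> = Transposition.transpose (\<pi> i) j \<circ> \<pi>"
  have \<rho>: "bij \<rho>" "\<rho> i = j" "\<And>x. curv (D (\<rho> x)) = curv (C x)"
  proof -
    show "bij \<rho>" unfolding \<rho>_def using \<open>bij \<pi>\<close> by (intro bij_comp bij_transpose)
    show "\<rho> i = j" by (simp add: \<rho>_def)
    have "curv (D (\<pi> i)) = curv (D j)"
      using \<pi>[THEN bspec, of i] i(1) j(1) \<open>k = l\<close> by simp
    then show "curv (D (\<rho> x)) = curv (C x)" for x
      using \<pi> by (simp add: \<rho>_def Transposition.transpose_def)
  qed
  have gram_C: "gram (Wmat C)"
    using C(1) unfolding descartes_iff_gram[OF C(3)] by simp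
  have "gram (Wmat (D \<circ> \<rho>))"
    using descartes_iff_gram[of "D \<circ> \<rho>"] descartes_permute[OF D(1) \<rho>(1)] \<rho>(3) C(3) by simp
  obtain M \<epsilon> where M: "M \<in> orbit" and \<epsilon>: "\<And>i. \<epsilon> i \<in> {1, -1::real}" and row: "\<And>i. M $ i = \<epsilon> i *\<^sub>R wrow (C i)"
    using C(2) unfolding in_super_orbit_iff_orbit by blast
  obtain N \<delta> where N: "N \<in> orbit" and \<delta>: "\<And>i. \<delta> i \<in> {1, -1::real}" and rowN: "\<And>i. N $ i = \<delta> i *\<^sub>R wrow (D i)"
    using D(2) unfolding in_super_orbit_iff_orbit by blast
  \<comment> \<open>Both Gram matrices have \<open>-1\<close> off the diagonal, so the signs can
    only be a common change of orientation.\<close>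
  have \<epsilon>_const: "\<epsilon> x = \<epsilon> i" for x
  proof (cases "x = i")
    case False
    have "ip (M $ x) (M $ i) = -1" "ip (wrow (C x)) (wrow (C i)) = -1"
      using gram_orbit[OF M] gram_C False by (simp_all add: gram_def Wmat_def)
    then have "\<epsilon> x * \<epsilon> i = 1" by (simp add: row ip_simps mult.commute)
    then show ?thesis using \<epsilon>[of x] \<epsilon>[of i] by auto
  qed simp
  define \<sigma> where "\<sigma> = \<epsilon> i"
  have \<sigma>: "\<sigma> = 1 \<or> \<sigma> = -1" using \<epsilon>[of i] by (simp add: \<sigma>_def)
  have row: "M $ x = \<sigma> *\<^sub>R wrow (C x)" for x using row[of x] \<epsilon>_const[of x] by (simp add: \<sigma>_def)
  have curv_row: "wrow E $ 2 = curv E" for E by (cases E) auto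
  \<comment> \<open>The orientation sign of the first configuration is put on the second, so that
    the curvatures agree exactly. The signs \<delta> are harmless because the lattice is closed
    under negation.\<close>
  let ?N = "\<sigma> *\<^sub>R Wmat (D \<circ> \<rho>)"
  have "gram ?N"
    using \<sigma> \<open>gram (Wmat (D \<circ> \<rho>))\<close> by (intro gram_scaleR) auto
  moreover have "?N $ x \<in> row_lattice" for x
  proof -
    have "?N $ x = N $ \<rho> x \<or> ?N $ x = - N $ \<rho> x"
      using \<sigma> \<delta>[of "\<rho> x"] by (auto simp: Wmat_def rowN)
    then show ?thesis
      using row_lattice_orbit[OF N] row_lattice_uminus by metis
  qed
  moreover have "?N $ x $ 2 = M $ x $ 2" for x
    by (simp add: Wmat_def row curv_row \<rho>(3))
  ultimately obtain \<alpha> \<beta> and s t :: int where \<alpha>: "\<alpha> \<in> {1, -1}" and \<beta>: "\<beta> \<in> {1, -1}"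
    and st: "?N $ i $ 3 = \<alpha> * M $ i $ 3 + 2 * of_int s * M $ i $ 2"
      "?N $ i $ 4 = \<beta> * M $ i $ 4 + 2 * of_int t * M $ i $ 2"
    using orbit_determined_by_curvatures[OF M] by metis
  have "k * Re w = k * (\<alpha> * Re z + 2 * of_int s)" "k * Im w = k * (\<beta> * Im z + 2 * of_int t)"
    using st \<sigma> by (auto simp: Wmat_def row \<rho>(2) i(1) j(1) \<open>k = l\<close> algebra_simps)
  then have "Re w = \<alpha> * Re z + 2 * of_int s" "Im w = \<beta> * Im z + 2 * of_int t"
    by (simp_all only: mult_left_cancel[OF k])
  then have "Re w = Re z" "Im w = Im z"
    using C(5) D(4) unit_interval_reflection_unique[OF \<alpha>, of "Re w" "Re z" s]
      unit_interval_reflection_unique[OF \<beta>, of "Im w" "Im z" t]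
    by (simp_all add: unit_square_def)
  then show ?thesis by (simp add: complex_eq_iff)
qed

section \<open>Existence of the configuration\<close>

text \<open>The whole configuration is reflected each time, which keeps all curvatures. Vertical
  reflections leave the x-coordinate alone, so x is treated first (\<open>P\<close>) and then y
  (\<open>Q\<close>).\<close>

lemma orbit_row_in_unit_square:
  assumes "M \<in> orbit" and nz: "M $ i $ 2 \<noteq> 0"
  shows "\<exists>N\<in>orbit. (\<forall>j. N $ j $ 2 = M $ j $ 2) \<and>
           (\<exists>x y. 0 \<le> x \<and> x \<le> 1 \<and> 0 \<le> y \<and> y \<le> 1 \<and> N $ i $ 3 = x * M $ i $ 2 \<and> N $ i $ 4 = y * M $ i $ 2)"
proof -
  define P where "P x \<longleftrightarrow> (\<exists>N\<in>orbit. (\<forall>j. N $ j $ 2 = M $ j $ 2) \<and> N $ i $ 3 = x * M $ i $ 2)" for x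
  have "P (M $ i $ 3 / M $ i $ 2)"
    unfolding P_def by (rule bexI[OF _ assms(1)]) (simp add: nz)
  moreover have "P (- x)" if P: "P x" for x
  proof -
    obtain N where N: "N \<in> orbit" "\<And>j. N $ j $ 2 = M $ j $ 2" "N $ i $ 3 = x * M $ i $ 2"
      using P unfolding P_def by blast
    show ?thesis
      unfolding P_def
      by (rule bexI[OF _ orbit_reflections(1)[OF N(1)]]) (simp add: N(2-) algebra_simps)
  qed
  moreover have "P (2 - x)" if P: "P x" for x
  proof -
    obtain N where N: "N \<in> orbit" "\<And>j. N $ j $ 2 = M $ j $ 2" "N $ i $ 3 = x * M $ i $ 2"
      using P unfolding P_def by blast
    show ?thesis
      unfolding P_def
      by (rule bexI[OF _ orbit_reflections(3)[OF N(1)]]) (simp add: N(2-) algebra_simps)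
  qed
  ultimately obtain x where x: "0 \<le> x" "x \<le> 1" "P x"
    using reflections_reach_unit_interval by blast
  define Q where "Q y \<longleftrightarrow> (\<exists>N\<in>orbit. (\<forall>j. N $ j $ 2 = M $ j $ 2) \<and>
      N $ i $ 3 = x * M $ i $ 2 \<and> N $ i $ 4 = y * M $ i $ 2)" for y
  obtain N where N: "N \<in> orbit" "\<And>j. N $ j $ 2 = M $ j $ 2" "N $ i $ 3 = x * M $ i $ 2"
    using x(3) unfolding P_def by blast
  have "Q (N $ i $ 4 / M $ i $ 2)"
    unfolding Q_def by (rule bexI[OF _ N(1)]) (simp add: nz N)
  moreover have "Q (- y)" if Q: "Q y" for y
  proof -
    obtain N where N: "N \<in> orbit" "\<And>j. N $ j $ 2 = M $ j $ 2" "N $ i $ 3 = x * M $ i $ 2" "N $ i $ 4 = y * M $ i $ 2"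
      using Q unfolding Q_def by blast
    show ?thesis
      unfolding Q_def
      by (rule bexI[OF _ orbit_reflections(2)[OF N(1)]]) (simp add: N(2-) algebra_simps)
  qed
  moreover have "Q (2 - y)" if Q: "Q y" for y
  proof -
    obtain N where N: "N \<in> orbit" "\<And>j. N $ j $ 2 = M $ j $ 2" "N $ i $ 3 = x * M $ i $ 2" "N $ i $ 4 = y * M $ i $ 2"
      using Q unfolding Q_def by blast
    show ?thesis
      unfolding Q_def
      by (rule bexI[OF _ orbit_reflections(4)[OF N(1)]]) (simp add: N(2-) algebra_simps)
  qed
  ultimately obtain y where "0 \<le> y" "y \<le> 1" "Q y"
    using reflections_reach_unit_interval by blast
  with x show ?thesis unfolding Q_def by blast
qed

theorem theorem6p2:
  fixes a b c d :: int
  assumes "integral_descartes_quadruple a b c d"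
    and "primitive a b c d"
    and "{#a, b, c, d#} \<noteq> {#0, 0, 1, 1#}"
    and "a \<noteq> 0" "b \<noteq> 0" "c \<noteq> 0" "d \<noteq> 0"
  shows "\<exists>!z. z \<in> unit_square \<and>
           (\<exists>C. descartes C \<and> in_super_orbit C \<and>
                curv_mset C = {#of_int a, of_int b, of_int c, of_int d#} \<and>
                largest_circle_center C z)"
proof -
  have curv_mem: "curv (C i) \<in> {of_int a, of_int b, of_int c, of_int d}"
    if "curv_mset C = {#of_int a, of_int b, of_int c, of_int d#}" for C i
  proof -
    have "curv (C i) \<in># curv_mset C" by (simp add: curv_mset_def)
    with that show ?thesis by simp
  qed
  have curv_nz: "curv (C i) \<noteq> 0"
    if "curv_mset C = {#of_int a, of_int b, of_int c, of_int d#}" for C i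
    using curv_mem[OF that, of i] assms(4-7) by auto
  obtain C where C: "descartes C" and C_curv: "curv_mset C = {#of_int a, of_int b, of_int c, of_int d#}"
    using assms(1) unfolding integral_descartes_quadruple_def by blast
  have gram_C: "gram (Wmat C)" and pos: "\<And>i j. i \<noteq> j \<Longrightarrow> curv (C i) + curv (C j) > 0"
    using C unfolding descartes_iff_gram[OF curv_nz[OF C_curv]] by simp_all
  have "\<exists>m::int. curv (C i) = of_int m" for i
    using curv_mem[OF C_curv, of i] by blast
  then obtain v :: "4 \<Rightarrow> int" where v: "\<And>i. curv (C i) = of_int (v i)" by metis
  have curv_row: "wrow E $ 2 = curv E" for E by (cases E) auto
  have "real_of_int (2 * (\<Sum>i\<in>UNIV. (v i)\<^sup>2)) = of_int ((\<Sum>i\<in>UNIV. v i)\<^sup>2)"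
    using gram_imp_descartes_relation[OF gram_C] by (simp add: Wmat_def curv_row v)
  then obtain M and g :: int where M: "M \<in> orbit" and g: "\<And>i. real_of_int (v i) = g * M $ i $ 2"
    using null_vector_multiple_of_orbit_curvatures unfolding of_int_eq_iff by blast
  \<comment> \<open>Orbit curvatures are integers, so \<open>g\<close> divides all entries, and
    primitivity leaves only \<open>1\<close> and \<open>-1\<close>.\<close>
  have "g dvd v i" for i
  proof -
    obtain q :: int where "M $ i $ 2 = of_int q"
      using row_latticeE[OF row_lattice_orbit[OF M]] by metis
    then have "real_of_int (v i) = of_int (g * q)" using g by simp
    then show ?thesis by (simp only: of_int_eq_iff dvd_triv_left)
  qed
  moreover have "\<exists>i. v i = m" if "m \<in> {a, b, c, d}" for m
  proof -
    have "real_of_int m \<in># curv_mset C" using that by (auto simp: C_curv)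
    then show ?thesis by (auto simp: curv_mset_def v)
  qed
  ultimately have "g dvd a" "g dvd b" "g dvd c" "g dvd d" by blast+
  then have "g dvd gcd a (gcd b (gcd c d))" by (intro gcd_greatest)
  then have "g dvd 1" using assms(2) by (simp only: primitive_def)
  then have g1: "g = 1 \<or> g = -1" by auto
  obtain i where i: "\<And>j. \<bar>v i\<bar> \<le> \<bar>v j\<bar>"
    using Min_in[of "range (\<lambda>i. \<bar>v i\<bar>)"] Min_le[of "range (\<lambda>i. \<bar>v i\<bar>)"] by fastforce
  have nz: "v j \<noteq> 0" for j using curv_nz[OF C_curv, of j] v[of j] by simp
  then have "M $ i $ 2 \<noteq> 0" using g[of i] by auto
  then obtain N x y where N: "N \<in> orbit" "\<And>j. N $ j $ 2 = M $ j $ 2"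
    and xy: "0 \<le> x" "x \<le> 1" "0 \<le> y" "y \<le> 1" "N $ i $ 3 = x * M $ i $ 2" "N $ i $ 4 = y * M $ i $ 2"
    using orbit_row_in_unit_square[OF M] by metis
  \<comment> \<open>Centers are read off from the rows of \<open>N\<close>, curvatures from
    \<open>v\<close>; the factor \<open>g\<close> between them is a common change of
    orientation.\<close>
  define D where "D = (\<lambda>j. Circ (Complex (N $ j $ 3 / N $ j $ 2) (N $ j $ 4 / N $ j $ 2)) (of_int (v j)))"
  have N2: "N $ j $ 2 = g * v j" "N $ j $ 2 \<noteq> 0" for j
    using g[of j] N(2)[of j] g1 nz[of j] by auto
  have row: "wrow (D j) = of_int g *\<^sub>R N $ j" for j
  proof -
    \<comment> \<open>Square one determines the first coordinate from the other three, so the row is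
      indeed that of a circle.\<close>
    have "ip (N $ j) (N $ j) = 1" using gram_orbit[OF N(1)] by (simp add: gram_def)
    then have "N $ j $ 1 * N $ j $ 2 = (N $ j $ 3)\<^sup>2 + (N $ j $ 4)\<^sup>2 - 1"
      by (simp add: ip_def power2_eq_square)
    then have 1: "N $ j $ 1 = ((N $ j $ 3)\<^sup>2 + (N $ j $ 4)\<^sup>2 - 1) / N $ j $ 2"
      using N2(2)[of j] by (simp add: field_simps)
    have v: "real_of_int (v j) = g * N $ j $ 2"
      using N2(1)[of j] g1 by auto
    have 2: "(cmod (Complex (N $ j $ 3 / N $ j $ 2) (N $ j $ 4 / N $ j $ 2)))\<^sup>2
        = ((N $ j $ 3)\<^sup>2 + (N $ j $ 4)\<^sup>2) / (N $ j $ 2)\<^sup>2"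
      by (simp add: cmod_power2 power_divide add_divide_distrib)
    show ?thesis
      using g1 N2(2)[of j] unfolding D_def wrow.simps v 2
      by (auto simp: vec_eq_iff forall_4 1 field_simps power2_eq_square)
  qed
  have D_curv: "curv (D j) = curv (C j)" for j by (simp add: D_def v)
  have "Wmat D = of_int g *\<^sub>R N" by (simp add: vec_eq_iff Wmat_def row)
  then have "gram (Wmat D)"
    using g1 by (simp only:) (intro gram_scaleR gram_orbit N(1), auto)
  \<comment> \<open>The curvature sums are positive because they are those of
    \<open>C\<close>.\<close>
  then have "descartes D"
    using descartes_iff_gram[of D] D_curv curv_nz[OF C_curv] pos by simp
  moreover have "in_super_orbit D"
    unfolding in_super_orbit_iff_orbit
    by (rule bexI[OF _ N(1)], rule exI[of _ "\<lambda>_. of_int g"]) (use g1 in \<open>auto simp: row\<close>)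
  moreover have mset_D: "curv_mset D = {#of_int a, of_int b, of_int c, of_int d#}"
    using C_curv by (simp add: curv_mset_def D_curv)
  moreover have "largest_circle_center D (Complex x y)"
    unfolding largest_circle_center_def
  proof (intro exI conjI allI)
    show "D i = Circ (Complex x y) (of_int (v i))"
      using xy(5,6) N2(2)[of i] by (simp add: D_def N(2))
    show "\<bar>real_of_int (v i)\<bar> \<le> \<bar>curv (D j)\<bar>" for j
      using i[of j] by (simp add: D_curv v flip: of_int_abs)
  qed
  moreover have "Complex x y \<in> unit_square" using xy by (simp add: unit_square_def)
  ultimately show ?thesis
    using largest_circle_center_unique[OF \<open>descartes D\<close> \<open>in_super_orbit D\<close> curv_nz[OF mset_D]]
    by (intro ex1I[of _ "Complex x y"]) auto
qed

end
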